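(* Let $p$ be a prime, $K$ a finite extension of $\mathbb{Q}_p$ with maximal ideal $\mathfrak{p}$ of $\mathcal{O}_K$. Let $x \in K$ be nonzero with $\nu_{\mathfrak{p}}(x) = bp^{k}$ where $b \in \mathbb{Q}$, $\nu_p(b) = 0$ and $k \geq 0$ an integer. Define $\kappa_0 := \nu_{\mathfrak{p}}(x) \bmod p$, $\kappa_1 := \nu_p(\lfloor \nu_{\mathfrak{p}}(x) \rfloor_p)$, and for $i \geq 2$, $\kappa_i := \nu_p(\lfloor \kappa_{i-1}-1 \rfloor_p)$ if $\kappa_{i-1} < +\infty$ and $\kappa_i := +\infty$ if $\kappa_{i-1}=+\infty$. If the $\nu_{\mathfrak{p}}$ sequence of $x$ is not eventually $+\infty$, then there is a unique positive integer $N$ with $1 \leq \kappa_N \leq p$ (and $\kappa_i=+\infty$ for $i>N$), and the $\mathrm{inc}_{\mathfrak{p}}$ sequence of $x$ is of the form \[(\underbrace{-1, -1, \ldots, -1}_{\kappa_0 \text{ copies}}, \mathcal{S}_{\kappa_1, p}, \mathcal{S}_{\kappa_2,p}, \ldots, \mathcal{S}_{\kappa_N,p}, \mathcal{S}_{\kappa_N,p}, \mathcal{S}_{\kappa_N,p}, \ldots)\] (concatenation of finite sequences, with $\mathcal{S}_{\kappa_N,p}$ repeated forever). As a result, the $\nu_{\mathfrak{p}}$ sequence and the $\mathrm{inc}_{\mathfrak{p}}$ sequence of $x$ are eventually periodic of period $\kappa_N$.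
   Context: $\nu_{\mathfrak{p}}$ is the unique discrete valuation on $K$ extending $\nu_p$ (so $\nu_{\mathfrak{p}}(p)=1$, values in $\mathbb{Q}\cup\{+\infty\}$). $D_{K,\mathfrak{p}}(x) = x\,\nu_{\mathfrak{p}}(x)/p$ for $x\neq 0$, $D_{K,\mathfrak{p}}(0)=0$; $D^i_{K,\mathfrak{p}}$ is the $i$-th iterate. The $\nu_{\mathfrak{p}}$ sequence of $x$ is $(\nu_{\mathfrak{p}}(D^i_{K,\mathfrak{p}}(x)))_{i\ge 0}$, and the $\mathrm{inc}_{\mathfrak{p}}$ sequence is $(\nu_{\mathfrak{p}}(D^{i+1}_{K,\mathfrak{p}}(x)) - \nu_{\mathfrak{p}}(D^{i}_{K,\mathfrak{p}}(x)))_{i \ge 0}$. For a rational number $r$ with $\nu_p(r) \geq 0$, $r \bmod p$ denotes the unique $s \in \{0,1,\ldots,p-1\}$ with $\nu_p(r-s) \geq 1$, and $\lfloor r \rfloor_p := r - (r \bmod p)$; $\nu_p(0)=+\infty$. For an integer $k \geq 1$, the $k$-segment is the finite sequence $\mathcal{S}_{k,p} := (k-1, -1, -1, \ldots, -1)$ with $(k-1 \bmod p)$ copies of $-1$. *)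

theory Defs
  imports
    "HOL-Computational_Algebra.Primes"
    "HOL-Algebra.QuotRing"
    "HOL-Algebra.Embedded_Algebras"
    "HOL-Library.Extended"
    "HOL-Library.Stream"
begin

fun fin_part :: "'a extended \<Rightarrow> 'a" where
  "fin_part (Fin a) = a"
| "fin_part \<infinity> = undefined"
| "fin_part (-\<infinity>) = undefined"


section \<open>The \<open>p\<close>-adic valuation on the rationals\<close>

definition nu :: "nat \<Rightarrow> rat \<Rightarrow> int extended" where
  "nu p r =
    (if r = 0 then \<infinity>
     else Fin (int (multiplicity (int p) (fst (quotient_of r)))
               - int (multiplicity (int p) (snd (quotient_of r)))))"

text \<open>The next two are meaningful only for arguments of nonnegative valuation.\<close>

definition rat_mod :: "nat \<Rightarrow> rat \<Rightarrow> nat" where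
  "rat_mod p r = (THE s. s < p \<and> 1 \<le> nu p (r - of_nat s))"

definition rat_floor :: "nat \<Rightarrow> rat \<Rightarrow> rat" where
  "rat_floor p r = r - of_nat (rat_mod p r)"


section \<open>The field of \<open>p\<close>-adic numbers\<close>

text \<open>The completion of the rationals: Cauchy sequences for the \<open>p\<close>-adic valuation,
  with pointwise operations, modulo null sequences.\<close>

definition padic_Cauchy :: "nat \<Rightarrow> (nat \<Rightarrow> rat) set" where
  "padic_Cauchy p = {a. \<forall>M. \<exists>n0. \<forall>m\<ge>n0. \<forall>n\<ge>n0. Fin M \<le> nu p (a m - a n)}"

definition padic_null :: "nat \<Rightarrow> (nat \<Rightarrow> rat) set" where
  "padic_null p = {a. \<forall>M. \<exists>n0. \<forall>n\<ge>n0. Fin M \<le> nu p (a n)}"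

definition Cauchy_ring :: "nat \<Rightarrow> (nat \<Rightarrow> rat) ring" where
  "Cauchy_ring p =
    \<lparr>carrier = padic_Cauchy p, mult = (\<lambda>a b n. a n * b n), one = (\<lambda>_. 1),
     zero = (\<lambda>_. 0), add = (\<lambda>a b n. a n + b n)\<rparr>"

definition Qp :: "nat \<Rightarrow> (nat \<Rightarrow> rat) set ring" where
  "Qp p = Cauchy_ring p Quot padic_null p"

definition Qp_of_rat :: "nat \<Rightarrow> rat \<Rightarrow> (nat \<Rightarrow> rat) set" where
  "Qp_of_rat p r = padic_null p +>\<^bsub>Cauchy_ring p\<^esub> (\<lambda>_. r)"

text \<open>Along a Cauchy sequence that is not null the valuation is eventually constant, and the
  constant depends only on the class of the sequence.\<close>

definition nu_Qp :: "nat \<Rightarrow> (nat \<Rightarrow> rat) set \<Rightarrow> int extended" where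
  "nu_Qp p X =
    (if X = \<zero>\<^bsub>Qp p\<^esub> then \<infinity>
     else Fin (THE w. \<forall>a\<in>X. eventually (\<lambda>n. nu p (a n) = Fin w) sequentially))"


section \<open>Finite extensions and their valuation\<close>

text \<open>\<open>h\<close> is the inclusion of the \<open>p\<close>-adic numbers into \<open>K\<close>.\<close>

definition finite_extension_Qp ::
    "nat \<Rightarrow> ('k, 'm) ring_scheme \<Rightarrow> ((nat \<Rightarrow> rat) set \<Rightarrow> 'k) \<Rightarrow> bool" where
  "finite_extension_Qp p K h \<longleftrightarrow>
    field K \<and> h \<in> ring_hom (Qp p) K \<and>
    ring.finite_dimension K (h ` carrier (Qp p)) (carrier K)"

definition discrete_valuation :: "('k, 'm) ring_scheme \<Rightarrow> ('k \<Rightarrow> rat extended) \<Rightarrow> bool" where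
  "discrete_valuation K v \<longleftrightarrow>
    v \<zero>\<^bsub>K\<^esub> = \<infinity> \<and>
    (\<forall>x\<in>carrier K. \<forall>y\<in>carrier K. v (x \<otimes>\<^bsub>K\<^esub> y) = v x + v y) \<and>
    (\<forall>x\<in>carrier K. \<forall>y\<in>carrier K. min (v x) (v y) \<le> v (x \<oplus>\<^bsub>K\<^esub> y)) \<and>
    (\<exists>c>0. v ` (carrier K - {\<zero>\<^bsub>K\<^esub>}) = range (\<lambda>n::int. Fin (of_int n * c)))"

definition extends_nu_Qp ::
    "nat \<Rightarrow> ((nat \<Rightarrow> rat) set \<Rightarrow> 'k) \<Rightarrow> ('k \<Rightarrow> rat extended) \<Rightarrow> bool" where
  "extends_nu_Qp p h v \<longleftrightarrow>
    (\<forall>a\<in>carrier (Qp p). v (h a) = map_extended of_int (nu_Qp p a))"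


section \<open>The arithmetic derivative and its sequences\<close>

definition arith_deriv ::
    "nat \<Rightarrow> ('k, 'm) ring_scheme \<Rightarrow> ((nat \<Rightarrow> rat) set \<Rightarrow> 'k) \<Rightarrow> ('k \<Rightarrow> rat extended)
      \<Rightarrow> 'k \<Rightarrow> 'k" where
  "arith_deriv p K h v x =
    (if x = \<zero>\<^bsub>K\<^esub> then \<zero>\<^bsub>K\<^esub>
     else x \<otimes>\<^bsub>K\<^esub> h (Qp_of_rat p (fin_part (v x) / of_nat p)))"

definition nu_seq ::
    "nat \<Rightarrow> ('k, 'm) ring_scheme \<Rightarrow> ((nat \<Rightarrow> rat) set \<Rightarrow> 'k) \<Rightarrow> ('k \<Rightarrow> rat extended)
      \<Rightarrow> 'k \<Rightarrow> nat \<Rightarrow> rat extended" where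
  "nu_seq p K h v x i = v ((arith_deriv p K h v ^^ i) x)"

definition inc_seq ::
    "nat \<Rightarrow> ('k, 'm) ring_scheme \<Rightarrow> ((nat \<Rightarrow> rat) set \<Rightarrow> 'k) \<Rightarrow> ('k \<Rightarrow> rat extended)
      \<Rightarrow> 'k \<Rightarrow> nat \<Rightarrow> rat extended" where
  "inc_seq p K h v x i = nu_seq p K h v x (Suc i) - nu_seq p K h v x i"

definition segment :: "nat \<Rightarrow> int \<Rightarrow> rat extended list" where
  "segment p k = Fin (of_int (k - 1)) # replicate (rat_mod p (of_int (k - 1))) (Fin (-1))"

fun kappa :: "nat \<Rightarrow> rat \<Rightarrow> nat \<Rightarrow> int extended" where
  "kappa p r 0 = Fin (int (rat_mod p r))"
| "kappa p r (Suc 0) = nu p (rat_floor p r)"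
| "kappa p r (Suc (Suc i)) =
    (if kappa p r (Suc i) < \<infinity>
     then nu p (rat_floor p (of_int (fin_part (kappa p r (Suc i)) - 1)))
     else \<infinity>)"

definition eventual_period :: "(nat \<Rightarrow> 'a) \<Rightarrow> nat \<Rightarrow> bool" where
  "eventual_period a T \<longleftrightarrow> 0 < T \<and> eventually (\<lambda>n. a (n + T) = a n) sequentially"

text \<open>The period of an eventually periodic sequence is its least eventual period.\<close>

definition eventually_periodic_of_period :: "(nat \<Rightarrow> 'a) \<Rightarrow> nat \<Rightarrow> bool" where
  "eventually_periodic_of_period a T \<longleftrightarrow>
    eventual_period a T \<and> (\<forall>T'. eventual_period a T' \<longrightarrow> T \<le> T')"

end

theory Submission
  imports Defs "HOL-Number_Theory.Cong"
begin

text \<open>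
  Since the valuation of \<open>D x\<close> is \<open>r + \<nu>\<^sub>p(r) - 1\<close> when \<open>x\<close> has valuation \<open>r \<noteq> 0\<close>, only the map
  \<open>r \<mapsto> r + \<nu>\<^sub>p(r) - 1\<close> on the rationals has to be understood. As long as \<open>p\<close> does not divide \<open>r\<close>
  it subtracts 1, so it runs down to \<open>\<lfloor>r\<rfloor>\<^sub>p\<close>. If \<open>\<nu>\<^sub>p(r) = n \<ge> 1\<close>, one jump by \<open>n - 1\<close> followed
  by such a descent leads to \<open>r + \<lfloor>n - 1\<rfloor>\<^sub>p\<close>; the increments on the way form the \<open>n\<close>-segment.
  For \<open>n > p\<close> the term \<open>\<lfloor>n - 1\<rfloor>\<^sub>p\<close> is positive and less than \<open>p\<^sup>n\<close>, so its valuation is smaller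
  than \<open>n\<close> and is the next valuation met; hence the \<open>\<kappa>\<^sub>i\<close> strictly decrease. For \<open>n \<le> p\<close> the term
  vanishes and the orbit has returned to \<open>r\<close>.
\<close>

section \<open>The \<open>p\<close>-adic valuation on the rationals\<close>

lemma nu_fraction:
  assumes p: "Factorial_Ring.prime p" and "a \<noteq> 0" "b \<noteq> 0"
  shows "nu p (of_int a / of_int b) =
    Fin (int (multiplicity (int p) a) - int (multiplicity (int p) b))"
proof -
  define c d where "c = fst (quotient_of (of_int a / of_int b))"
    and "d = snd (quotient_of (of_int a / of_int b))"
  have q: "quotient_of (of_int a / of_int b) = (c, d)" by (simp add: c_def d_def)
  have d: "d > 0" using quotient_of_denom_pos[OF q] .
  have eq: "of_int a / of_int b = (of_int c / of_int d :: rat)" using quotient_of_div[OF q] .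
  \<comment> \<open>Cross-multiplying with the reduced fraction \<open>c / d\<close> turns the claim
    into additivity of multiplicities over products of integers.\<close>
  then have "of_int a * of_int d = (of_int c * of_int b :: rat)"
    using assms d by (simp add: field_simps)
  then have ad: "a * d = c * b" by (metis of_int_eq_iff of_int_mult)
  have c: "c \<noteq> 0" using ad assms d by auto
  have pr: "prime_elem (int p)" using p by (simp add: prime_imp_prime_elem)
  have "multiplicity (int p) a + multiplicity (int p) d
      = multiplicity (int p) c + multiplicity (int p) b"
    using arg_cong[OF ad, of "multiplicity (int p)"] assms c d
    by (simp add: prime_elem_multiplicity_mult_distrib[OF pr])
  moreover have "of_int a / of_int b \<noteq> (0::rat)" using assms by simp
  ultimately show ?thesis unfolding nu_def q by simp
qed

lemma nu_0 [simp]: "nu p 0 = \<infinity>"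
  by (simp add: nu_def)

lemma nu_eq_infinity_iff [simp]: "nu p r = \<infinity> \<longleftrightarrow> r = 0"
  by (simp add: nu_def)

lemma nu_finite:
  assumes "r \<noteq> 0"
  obtains n where "nu p r = Fin n"
  using assms by (simp add: nu_def)

lemma nu_of_int:
  assumes "Factorial_Ring.prime p" "a \<noteq> 0"
  shows "nu p (of_int a) = Fin (int (multiplicity (int p) a))"
  using nu_fraction[OF assms, of 1] by simp

lemma rat_fraction:
  fixes r :: rat
  obtains a b :: int where "r = of_int a / of_int b" "b > 0" "coprime a b"
proof (cases "quotient_of r")
  case (Pair a b)
  then show ?thesis
    using that quotient_of_coprime quotient_of_denom_pos quotient_of_div by blast
qed

lemma nu_mult:
  assumes p: "Factorial_Ring.prime p"
  shows "nu p (r * s) = nu p r + nu p s"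
proof (cases "r = 0 \<or> s = 0")
  case True
  then show ?thesis by (auto simp: nu_def)
next
  case False
  obtain a b where r: "r = of_int a / of_int b" "b > 0" by (rule rat_fraction)
  obtain c d where s: "s = of_int c / of_int d" "d > 0" by (rule rat_fraction)
  have pr: "prime_elem (int p)" using p by (simp add: prime_imp_prime_elem)
  have "r * s = of_int (a * c) / of_int (b * d)" using r s by simp
  then show ?thesis
    using False r s nu_fraction[OF p, of "a * c" "b * d"] nu_fraction[OF p, of a b]
      nu_fraction[OF p, of c d]
    by (simp add: prime_elem_multiplicity_mult_distrib[OF pr])
qed

lemma nu_of_int_ge_iff:
  assumes p: "Factorial_Ring.prime p"
  shows "Fin (int n) \<le> nu p (of_int a) \<longleftrightarrow> int p ^ n dvd a"
proof (cases "a = 0")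
  case False
  then show ?thesis using nu_of_int[OF p False] prime_gt_1_nat[OF p]
    by (simp add: power_dvd_iff_le_multiplicity)
qed simp

lemma nu_of_int_nonneg: "Factorial_Ring.prime p \<Longrightarrow> 0 \<le> nu p (of_int a)"
  using nu_of_int_ge_iff[of p 0 a] by (simp add: zero_extended_def)

lemma nu_of_int_ge_1_iff: "Factorial_Ring.prime p \<Longrightarrow> 1 \<le> nu p (of_int a) \<longleftrightarrow> int p dvd a"
  using nu_of_int_ge_iff[of p 1 a] by (simp add: one_extended_def)

lemma nu_uminus [simp]:
  assumes p: "Factorial_Ring.prime p"
  shows "nu p (- r) = nu p r"
proof -
  have "nu p (-1) = 0"
    using nu_of_int[OF p, of "-1"] by (simp add: multiplicity_unit_right zero_extended_def)
  then show ?thesis using nu_mult[OF p, of "-1" r] by simp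
qed

text \<open>Over the common denominator \<open>b * d\<close> the claim concerns the numerators only:
  the smaller of the two powers of \<open>p\<close> dividing them divides their sum.\<close>

lemma nu_add_ge:
  assumes p: "Factorial_Ring.prime p"
  shows "min (nu p r) (nu p s) \<le> nu p (r + s)"
proof (cases "r = 0 \<or> s = 0 \<or> r + s = 0")
  case True
  then show ?thesis by (auto simp: nu_def)
next
  case False
  obtain a b where r: "r = of_int a / of_int b" "b > 0" by (rule rat_fraction)
  obtain c d where s: "s = of_int c / of_int d" "d > 0" by (rule rat_fraction)
  have e1: "r = of_int (a * d) / of_int (b * d)" using r s by simp
  have e2: "s = of_int (c * b) / of_int (b * d)" using r s by simp
  have e3: "r + s = of_int (a * d + c * b) / of_int (b * d)"
    using r s by (simp add: field_simps)
  let ?m = "multiplicity (int p)"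
  define k where "k = min (?m (a * d)) (?m (c * b))"
  have nz: "a * d \<noteq> 0" "c * b \<noteq> 0" "a * d + c * b \<noteq> 0" "b * d \<noteq> 0"
    using False e1 e2 e3 r s by (fastforce, fastforce, force, force)
  have "int p ^ k dvd a * d + c * b"
    by (intro dvd_add multiplicity_dvd') (auto simp: k_def)
  then have "k \<le> ?m (a * d + c * b)"
    using prime_gt_1_nat[OF p] nz by (intro multiplicity_geI) auto
  then show ?thesis
    using nz nu_fraction[OF p nz(1) nz(4)] nu_fraction[OF p nz(2) nz(4)]
      nu_fraction[OF p nz(3) nz(4)]
    by (simp add: e3[symmetric] e1[symmetric] e2[symmetric] k_def min_def
          del: of_int_add of_int_mult split: if_splits)
qed

lemma nu_diff_ge:
  "Factorial_Ring.prime p \<Longrightarrow> min (nu p r) (nu p s) \<le> nu p (r - s)"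
  using nu_add_ge[of p r "- s"] by simp

text \<open>Apart from \<open>nu_add_ge\<close>, the ultrametric inequality is used for
  \<open>r = (r + s) - s\<close>: if \<open>r + s\<close> had larger valuation than
  \<open>r\<close>, so would \<open>r\<close> itself.\<close>

lemma nu_add_eq:
  assumes p: "Factorial_Ring.prime p" and "nu p r < nu p s"
  shows "nu p (r + s) = nu p r"
proof -
  have "min (nu p r) (nu p s) \<le> nu p (r + s)" by (rule nu_add_ge[OF p])
  moreover have "min (nu p (r + s)) (nu p s) \<le> nu p r"
    using nu_diff_ge[OF p, of "r + s" s] by simp
  ultimately show ?thesis using assms(2) by (auto simp: min_def split: if_splits)
qed

section \<open>Residues and floors modulo \<open>p\<close>\<close>

lemma residue_exists:
  assumes p: "Factorial_Ring.prime p" and r: "0 \<le> nu p r"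
  shows "\<exists>s<p. 1 \<le> nu p (r - of_nat s)"
proof (cases "r = 0")
  case True
  then show ?thesis using prime_gt_0_nat[OF p] by (intro exI[of _ 0]) simp
next
  case False
  obtain a b where ab: "r = of_int a / of_int b" "b > 0" "coprime a b" by (rule rat_fraction)
  have pi: "Factorial_Ring.prime (int p)" using p by simp
  have a: "a \<noteq> 0" using False ab by auto
  have le: "multiplicity (int p) b \<le> multiplicity (int p) a"
    using r nu_fraction[OF p a, of b] ab by (simp add: zero_extended_def)
  \<comment> \<open>In lowest terms, a factor \<open>p\<close> of the denominator would have to
    divide the numerator too, since the valuation is nonnegative.\<close>
  have nd: "\<not> int p dvd b"
  proof
    assume *: "int p dvd b"
    then have "0 < multiplicity (int p) b"
      using ab prime_gt_1_nat[OF p] by (subst multiplicity_gt_zero_iff) auto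
    then have "int p dvd a" using le a prime_gt_1_nat[OF p]
      by (metis not_dvd_imp_multiplicity_0 le_zero_eq less_numeral_extra(3))
    with * have "is_unit (int p)" using ab(3) coprime_common_divisor by blast
    then show False using pi not_prime_unit by blast
  qed
  then have "coprime b (int p)" using prime_imp_coprime[OF pi] coprime_commute by blast
  then obtain x where x: "[b * x = 1] (mod int p)" using cong_solve_coprime_int by blast
  \<comment> \<open>As \<open>x\<close> inverts the denominator modulo \<open>p\<close>, the residue
    of \<open>a / b\<close> is that of \<open>a * x\<close>.\<close>
  define s where "s = nat ((a * x) mod int p)"
  have s: "int s = (a * x) mod int p" using prime_gt_0_nat[OF p] by (simp add: s_def)
  have "[int s * b = a * x * b] (mod int p)" unfolding s by (simp add: cong_def mod_mult_left_eq)
  also have "[a * x * b = a * 1] (mod int p)"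
    using cong_scalar_left[OF x, of a] by (simp add: mult.commute mult.left_commute)
  finally have d: "int p dvd a - int s * b"
    by (metis cong_iff_dvd_diff cong_sym mult.right_neutral)
  have eq: "r - of_nat s = of_int (a - int s * b) * (of_int 1 / of_int b)"
    using ab by (simp add: field_simps)
  have "nu p (of_int 1 / of_int b) = 0"
    using nu_fraction[OF p, of 1 b] ab(2) not_dvd_imp_multiplicity_0[OF nd]
    by (simp add: zero_extended_def)
  then have "1 \<le> nu p (r - of_nat s)"
    unfolding eq nu_mult[OF p] using nu_of_int_ge_1_iff[OF p, of "a - int s * b"] d
    by (simp del: of_int_diff of_int_mult)
  moreover have "s < p" using s prime_gt_0_nat[OF p]
    by (metis of_nat_0_less_iff of_nat_less_iff pos_mod_bound)
  ultimately show ?thesis by blast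
qed

text \<open>Two such residues differ by a multiple of \<open>p\<close> that is smaller than
  \<open>p\<close> in absolute value. Together with existence this makes the description in
  \<open>rat_mod\<close> proper.\<close>

lemma residue_unique:
  assumes p: "Factorial_Ring.prime p" and "s < p" "t < p"
    and "1 \<le> nu p (r - of_nat s)" "1 \<le> nu p (r - of_nat t)"
  shows "s = t"
proof -
  have "1 \<le> nu p ((r - of_nat s) - (r - of_nat t))"
    using nu_diff_ge[OF p] assms(4,5) by (meson min.boundedI order_trans)
  then have "1 \<le> nu p (of_int (int t - int s))" by simp
  then have "int p dvd int t - int s" using nu_of_int_ge_1_iff[OF p] by blast
  then have "[int t = int s] (mod int p)" by (simp add: cong_iff_dvd_diff)
  then show ?thesis using assms(2,3) by (simp add: cong_def)
qed

lemma rat_mod_eqI: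
  assumes "Factorial_Ring.prime p" "s < p" "1 \<le> nu p (r - of_nat s)"
  shows "rat_mod p r = s"
  unfolding rat_mod_def using assms residue_unique by (intro the_equality) blast+

lemma
  assumes "Factorial_Ring.prime p" "0 \<le> nu p r"
  shows rat_mod_less: "rat_mod p r < p"
    and nu_rat_floor_ge_1: "1 \<le> nu p (rat_floor p r)"
  using residue_exists[OF assms] rat_mod_eqI[OF assms(1)] by (auto simp: rat_floor_def)

lemma rat_mod_of_int:
  assumes p: "Factorial_Ring.prime p"
  shows "rat_mod p (of_int a) = nat (a mod int p)"
proof (rule rat_mod_eqI[OF p])
  have pos: "int p > 0" using prime_gt_0_nat[OF p] by simp
  then show "nat (a mod int p) < p" by (simp add: nat_less_iff)
  have "(of_int a - of_nat (nat (a mod int p)) :: rat) = of_int (a - a mod int p)"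
    using pos by simp
  then show "1 \<le> nu p (of_int a - of_nat (nat (a mod int p)))"
    using nu_of_int_ge_1_iff[OF p, of "a - a mod int p"] by (simp add: minus_mod_eq_mult_div)
qed

lemma rat_floor_of_int:
  assumes p: "Factorial_Ring.prime p"
  shows "rat_floor p (of_int a) = of_int (int p * (a div int p))"
proof -
  have "rat_floor p (of_int a) = of_int (a - a mod int p)"
    using prime_gt_0_nat[OF p] by (simp add: rat_floor_def rat_mod_of_int[OF p])
  then show ?thesis by (simp only: minus_mod_eq_mult_div)
qed

section \<open>Rational constants in the \<open>p\<close>-adic field and the valuation of the
  derivative\<close>

lemma padic_null_const_iff: "(\<lambda>_. r) \<in> padic_null p \<longleftrightarrow> r = 0"
proof
  assume *: "(\<lambda>_. r) \<in> padic_null p"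
  show "r = 0"
  proof (rule ccontr)
    assume "r \<noteq> 0"
    then obtain n where "nu p r = Fin n" by (rule nu_finite)
    moreover from * have "Fin (n + 1) \<le> nu p r" unfolding padic_null_def by blast
    ultimately show False by simp
  qed
qed (simp add: padic_null_def)

lemma Qp_of_rat_eq: "Qp_of_rat p r = {\<lambda>n. a n + r |a. a \<in> padic_null p}"
  by (auto simp: Qp_of_rat_def a_r_coset_def r_coset_def Cauchy_ring_def)

lemma zero_Qp: "\<zero>\<^bsub>Qp p\<^esub> = padic_null p"
  by (simp add: Qp_def FactRing_def)

lemma Qp_of_rat_carrier: "Qp_of_rat p r \<in> carrier (Qp p)"
proof -
  have "(\<lambda>_. r) \<in> carrier (Cauchy_ring p)" by (simp add: Cauchy_ring_def padic_Cauchy_def)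
  then show ?thesis
    by (auto simp: Qp_def FactRing_def A_RCOSETS_def' Qp_of_rat_def)
qed

text \<open>A representative of the class of \<open>r \<noteq> 0\<close> is \<open>r\<close> plus a
  null sequence, whose terms eventually have valuation above that of \<open>r\<close> and then do
  not affect the valuation of the sum.\<close>

lemma nu_Qp_of_rat:
  assumes p: "Factorial_Ring.prime p"
  shows "nu_Qp p (Qp_of_rat p r) = nu p r"
proof (cases "r = 0")
  case True
  then have "Qp_of_rat p r = \<zero>\<^bsub>Qp p\<^esub>" by (auto simp: Qp_of_rat_eq zero_Qp)
  then show ?thesis using True by (simp add: nu_Qp_def)
next
  case False
  obtain n where n: "nu p r = Fin n" using False by (rule nu_finite)
  have zero_null: "(\<lambda>_. 0) \<in> padic_null p" by (simp add: padic_null_const_iff)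
  then have const: "(\<lambda>_. r) \<in> Qp_of_rat p r" by (force simp: Qp_of_rat_eq)
  then have nz: "Qp_of_rat p r \<noteq> \<zero>\<^bsub>Qp p\<^esub>"
    using False by (auto simp: zero_Qp padic_null_const_iff)
  have "\<forall>a\<in>Qp_of_rat p r. eventually (\<lambda>m. nu p (a m) = Fin n) sequentially"
  proof
    fix a assume "a \<in> Qp_of_rat p r"
    then obtain c where c: "c \<in> padic_null p" "a = (\<lambda>m. c m + r)"
      by (auto simp: Qp_of_rat_eq)
    then obtain n0 where n0: "\<forall>m\<ge>n0. Fin (n + 1) \<le> nu p (c m)"
      unfolding padic_null_def by blast
    show "eventually (\<lambda>m. nu p (a m) = Fin n) sequentially"
      unfolding eventually_sequentially
    proof (intro exI allI impI)
      fix m assume "n0 \<le> m"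
      then have "Fin (n + 1) \<le> nu p (c m)" using n0 by blast
      then have "nu p r < nu p (c m)" unfolding n by (cases "nu p (c m)") auto
      then show "nu p (a m) = Fin n" using nu_add_eq[OF p, of r "c m"] n c by (simp add: add.commute)
    qed
  qed
  \<comment> \<open>The constant sequence is one of the representatives, which already determines
    \<open>w\<close>.\<close>
  moreover have "w = n"
    if "\<forall>a\<in>Qp_of_rat p r. eventually (\<lambda>m. nu p (a m) = Fin w) sequentially" for w
    using that const n by fastforce
  ultimately have "(THE w. \<forall>a\<in>Qp_of_rat p r. eventually (\<lambda>m. nu p (a m) = Fin w) sequentially) = n"
    by (intro the_equality) blast+
  then show ?thesis using nz n by (simp add: nu_Qp_def)
qed

text \<open>The effect of the derivative on a finite nonzero valuation. At \<open>r = 0\<close> the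
  body applies \<open>fin_part\<close> to infinity, so the value there carries no meaning.\<close>

definition val_step :: "nat \<Rightarrow> rat \<Rightarrow> rat" where
  "val_step p r = r + of_int (fin_part (nu p r) - 1)"

text \<open>The derivative multiplies \<open>y\<close> by the rational \<open>r / p\<close>, of
  valuation \<open>nu p r - 1\<close> when \<open>r \<noteq> 0\<close>. For \<open>r = 0\<close>
  this factor is 0, and the valuation becomes infinite.\<close>

lemma arith_deriv_valuation:
  assumes p: "Factorial_Ring.prime p"
    and ext: "finite_extension_Qp p K h" and v: "discrete_valuation K v" "extends_nu_Qp p h v"
    and y: "y \<in> carrier K" "v y = Fin r"
  shows "arith_deriv p K h v y \<in> carrier K"
    and "v (arith_deriv p K h v y) = (if r = 0 then \<infinity> else Fin (val_step p r))"
proof -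
  interpret field K using ext by (simp add: finite_extension_Qp_def)
  let ?c = "h (Qp_of_rat p (r / of_nat p))"
  have c: "?c \<in> carrier K"
    using ext Qp_of_rat_carrier by (auto simp: finite_extension_Qp_def ring_hom_def)
  have "y \<noteq> \<zero>\<^bsub>K\<^esub>" using y v by (auto simp: discrete_valuation_def)
  then have d: "arith_deriv p K h v y = y \<otimes>\<^bsub>K\<^esub> ?c" by (simp add: arith_deriv_def y)
  then show "arith_deriv p K h v y \<in> carrier K" using y c by simp
  have vc: "v ?c = map_extended of_int (nu p (r / of_nat p))"
    using v(2) Qp_of_rat_carrier by (simp add: extends_nu_Qp_def nu_Qp_of_rat[OF p])
  have vd: "v (arith_deriv p K h v y) = Fin r + v ?c"
    using v(1) y c by (simp add: d discrete_valuation_def)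
  show "v (arith_deriv p K h v y) = (if r = 0 then \<infinity> else Fin (val_step p r))"
  proof (cases "r = 0")
    case True
    then show ?thesis using vd vc by simp
  next
    case False
    obtain n where n: "nu p r = Fin n" using False by (rule nu_finite)
    have p1: "int p \<noteq> 0" "\<not> is_unit (int p)" using p prime_gt_1_nat[OF p] by auto
    have "nu p (r / of_nat p) = Fin n + nu p (of_int 1 / of_int (int p))"
      using nu_mult[OF p, of r "1 / of_nat p"] n by simp
    also have "\<dots> = Fin (n - 1)"
      using p1 nu_fraction[OF p, of 1 "int p"] by (simp add: multiplicity_self)
    finally show ?thesis using False vd vc n by (simp add: val_step_def)
  qed
qed

text \<open>Discreteness gives all nonzero elements finite values, so \<open>y\<close> can only be
  zero.\<close>

lemma arith_deriv_infinite_valuation: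
  assumes v: "discrete_valuation K v" and "y \<in> carrier K" "v y = \<infinity>"
  shows "arith_deriv p K h v y = \<zero>\<^bsub>K\<^esub>"
proof -
  have "y = \<zero>\<^bsub>K\<^esub>"
  proof (rule ccontr)
    assume "y \<noteq> \<zero>\<^bsub>K\<^esub>"
    then have "v y \<in> range (\<lambda>q. Fin q)"
      using assms unfolding discrete_valuation_def by blast
    then show False using assms by auto
  qed
  then show ?thesis by (simp add: arith_deriv_def)
qed


section \<open>Orbits of \<open>val_step\<close> and their increments\<close>

definition increments :: "nat \<Rightarrow> rat \<Rightarrow> rat extended stream" where
  "increments p r = smap (\<lambda>q. Fin (val_step p q - q)) (siterate (val_step p) r)"

text \<open>Keeping the increments and the end point together lets pieces of an orbit be
  concatenated, and later yields the periods of both sequences.\<close>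

definition reaches :: "nat \<Rightarrow> rat \<Rightarrow> rat extended list \<Rightarrow> rat \<Rightarrow> bool" where
  "reaches p r us q \<longleftrightarrow>
    increments p r = us @- increments p q \<and> (val_step p ^^ length us) r = q"

lemma increments_unfold: "increments p r = Fin (val_step p r - r) ## increments p (val_step p r)"
  unfolding increments_def by (subst siterate.code) simp

lemma reaches_Nil: "reaches p r [] r"
  by (simp add: reaches_def)

lemma reaches_Cons:
  assumes "reaches p (val_step p r) us q"
  shows "reaches p r (Fin (val_step p r - r) # us) q"
  using assms increments_unfold[of p r] by (simp add: reaches_def funpow_swap1)

lemma reaches_append:
  assumes "reaches p r us q" "reaches p q vs t"
  shows "reaches p r (us @ vs) t"
  using assms by (auto simp: reaches_def add.commute[of "length us"] funpow_add)

text \<open>A nonzero residue is a \<open>p\<close>-adic unit, and \<open>r\<close> differs from it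
  by something of positive valuation. This is one step of the descent to the floor.\<close>

lemma nonzero_residue:
  assumes p: "Factorial_Ring.prime p" and r: "0 \<le> nu p r" and s: "rat_mod p r = Suc s"
  shows "nu p r = 0" "0 \<le> nu p (r - 1)" "rat_mod p (r - 1) = s"
proof -
  have sp: "Suc s < p" using rat_mod_less[OF p r] s by simp
  have fl: "1 \<le> nu p (r - of_nat (Suc s))"
    using nu_rat_floor_ge_1[OF p r] s by (simp add: rat_floor_def)
  have "\<not> int p dvd int (Suc s)"
    using sp by (metis int_dvd_int_iff nat_dvd_not_less zero_less_Suc)
  then have u: "nu p (of_nat (Suc s)) = 0"
    using nu_of_int[OF p, of "int (Suc s)"] not_dvd_imp_multiplicity_0[of "int p" "int (Suc s)"]
    by (simp add: zero_extended_def del: of_nat_Suc)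
  have "nu p (of_nat (Suc s)) < nu p (r - of_nat (Suc s))"
    unfolding u using fl by (cases "nu p (r - of_nat (Suc s))")
      (auto simp: one_extended_def zero_extended_def simp del: of_nat_Suc)
  from nu_add_eq[OF p this] show "nu p r = 0" using u by (simp del: of_nat_Suc)
  have "min (nu p r) (nu p 1) \<le> nu p (r - 1)" by (rule nu_diff_ge[OF p])
  then show "0 \<le> nu p (r - 1)"
    using r nu_of_int_nonneg[OF p, of 1] by (auto simp: min_def split: if_splits)
  show "rat_mod p (r - 1) = s"
    using fl sp by (intro rat_mod_eqI[OF p]) (simp_all add: algebra_simps)
qed

text \<open>Induction on the residue: while it is nonzero, \<open>val_step\<close> lowers both
  \<open>r\<close> and the residue by 1 and so keeps the floor.\<close>

lemma reaches_rat_floor: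
  assumes p: "Factorial_Ring.prime p"
  shows "0 \<le> nu p r \<Longrightarrow> reaches p r (replicate (rat_mod p r) (Fin (-1))) (rat_floor p r)"
proof (induction "rat_mod p r" arbitrary: r)
  case 0
  then show ?case using reaches_Nil[of p r] by (simp add: rat_floor_def)
next
  case (Suc s)
  note res = nonzero_residue[OF p Suc.prems Suc.hyps(2)[symmetric]]
  have st: "val_step p r = r - 1" using res(1) by (simp add: val_step_def zero_extended_def)
  have fl: "rat_floor p (r - 1) = rat_floor p r"
    using res(3) Suc.hyps(2)[symmetric] by (simp add: rat_floor_def)
  have "reaches p (r - 1) (replicate s (Fin (-1))) (rat_floor p r)"
    using Suc.hyps(1)[of "r - 1"] res fl by simp
  then show ?case
    using reaches_Cons[of p r] st Suc.hyps(2)[symmetric] by fastforce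
qed

text \<open>The jump leads to \<open>r + (n - 1)\<close>. Since \<open>r\<close> has positive
  valuation, this has the residue of \<open>n - 1\<close>, so the descent that follows has the
  length prescribed by \<open>segment\<close>.\<close>

lemma reaches_segment:
  assumes p: "Factorial_Ring.prime p" and r: "nu p r = Fin n" "1 \<le> n"
  shows "reaches p r (segment p n) (r + rat_floor p (of_int (n - 1)))"
proof -
  let ?a = "of_int (n - 1) :: rat"
  have st: "val_step p r = r + ?a" using r by (simp add: val_step_def)
  have a: "0 \<le> nu p ?a" by (rule nu_of_int_nonneg[OF p])
  have r1: "1 \<le> nu p r" using r by (simp add: one_extended_def)
  have ge: "0 \<le> nu p (r + ?a)"
  proof -
    have "0 \<le> nu p r" using r by (simp add: zero_extended_def)
    then show ?thesis using a nu_add_ge[OF p, of r ?a] by (meson min.boundedI order_trans)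
  qed
  have m: "rat_mod p (r + ?a) = rat_mod p ?a"
  proof (rule rat_mod_eqI[OF p])
    show "rat_mod p ?a < p" using rat_mod_less[OF p a] .
    have "min (nu p r) (nu p (rat_floor p ?a)) \<le> nu p (r + rat_floor p ?a)"
      by (rule nu_add_ge[OF p])
    then have "1 \<le> nu p (r + rat_floor p ?a)"
      using r1 nu_rat_floor_ge_1[OF p a] by (meson min.boundedI order_trans)
    then show "1 \<le> nu p (r + ?a - of_nat (rat_mod p ?a))"
      by (simp add: rat_floor_def add_diff_eq)
  qed
  then have fl: "rat_floor p (r + ?a) = r + rat_floor p ?a" by (simp add: rat_floor_def)
  show ?thesis
    using reaches_Cons[of p r "replicate (rat_mod p ?a) (Fin (-1))"]
      reaches_rat_floor[OF p ge] m fl st by (simp add: segment_def)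
qed

lemma rat_floor_pred_eq_0:
  assumes "Factorial_Ring.prime p" "1 \<le> n" "n \<le> int p"
  shows "rat_floor p (of_int (n - 1)) = 0"
  using assms by (simp add: rat_floor_of_int del: of_int_diff)

lemma nu_rat_floor_pred:
  assumes p: "Factorial_Ring.prime p" and n: "int p < n"
  obtains m where "nu p (rat_floor p (of_int (n - 1))) = Fin m" "1 \<le> m" "m < n"
proof -
  define c where "c = int p * ((n - 1) div int p)"
  have p0: "int p > 0" using prime_gt_0_nat[OF p] by simp
  have "0 < (n - 1) div int p" using n p0 by (simp add: pos_imp_zdiv_pos_iff)
  then have c0: "c > 0" using p0 by (simp add: c_def)
  have "c = (n - 1) - (n - 1) mod int p" by (simp add: c_def minus_mod_eq_mult_div)
  then have cn: "c \<le> n - 1" using pos_mod_sign[OF p0, of "n - 1"] by linarith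
  define m where "m = multiplicity (int p) c"
  have v: "nu p (rat_floor p (of_int (n - 1))) = Fin (int m)"
    unfolding rat_floor_of_int[OF p] m_def c_def[symmetric] using c0 by (intro nu_of_int[OF p]) simp
  have "1 \<le> Fin (int m)"
    using nu_rat_floor_ge_1[OF p nu_of_int_nonneg[OF p]] v by metis
  then have m1: "1 \<le> int m" by (simp add: one_extended_def)
  \<comment> \<open>The comparison is \<open>m < p ^ m \<le> c \<le> n - 1\<close>.\<close>
  have "int m < int p ^ m"
    using of_nat_less_iff[of m "p ^ m", where 'a = int] power_gt_expt[of p m] prime_gt_1_nat[OF p]
    by simp
  also have "\<dots> \<le> c" unfolding m_def by (rule zdvd_imp_le[OF multiplicity_dvd c0])
  finally show ?thesis using that v m1 cn by auto
qed

section \<open>Cyclic streams and least periods\<close>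

lemma shift_fixpoint_eq_cycle:
  assumes u: "u \<noteq> []" and s: "s = u @- s"
  shows "s = cycle u"
proof -
  \<comment> \<open>The bisimulation allows any common prefix \<open>ys\<close>: a nonempty one
    loses its head, and an empty one is refilled with \<open>u\<close> by unrolling both streams
    once.\<close>
  have "\<exists>ys. a = ys @- s \<and> b = ys @- cycle u \<Longrightarrow> a = b" for a b
  proof (coinduction arbitrary: a b)
    case Eq_stream
    then obtain ys where ys: "a = ys @- s" "b = ys @- cycle u" by blast
    obtain z zs where "a = (z # zs) @- s" "b = (z # zs) @- cycle u"
    proof (cases ys)
      case Nil
      then show ?thesis using that ys u s cycle_decomp[OF u] by (metis neq_Nil_conv shift.simps(1))
    next
      case (Cons z zs)
      then show ?thesis using that ys by blast
    qed
    then show ?case by auto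
  qed
  from this[of s "cycle u"] show ?thesis by (metis shift.simps(1))
qed

lemma cycle_snth: "u \<noteq> [] \<Longrightarrow> cycle u !! n = u ! (n mod length u)"
proof -
  assume u: "u \<noteq> []"
  have "cycle u !! n = shd (sdrop n (cycle u))" by simp
  also have "\<dots> = hd (rotate (n mod length u) u)"
    using u by (subst sdrop_cycle) simp_all
  also have "\<dots> = u ! (n mod length u)" using u by (simp add: hd_rotate_conv_nth)
  finally show ?thesis .
qed

lemma periodic_increments:
  assumes p: "Factorial_Ring.prime p" and r: "nu p r = Fin n" "1 \<le> n" "n \<le> int p"
  shows "reaches p r (segment p n) r" "increments p r = cycle (segment p n)"
    "length (segment p n) = nat n"
proof -
  show *: "reaches p r (segment p n) r"
    using reaches_segment[OF p r(1,2)] rat_floor_pred_eq_0[OF p r(2,3)] by simp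
  show "increments p r = cycle (segment p n)"
    using * by (intro shift_fixpoint_eq_cycle) (simp_all add: reaches_def segment_def)
  \<comment> \<open>As \<open>n - 1 < p\<close>, the residue of \<open>n - 1\<close> is
    \<open>n - 1\<close> itself, which gives \<open>1 + (n - 1)\<close> entries.\<close>
  show "length (segment p n) = nat n"
    using r rat_mod_of_int[OF p, of "n - 1"] by (simp add: segment_def del: of_int_diff)
qed

text \<open>The leading entry \<open>n - 1\<close> is nonnegative and all others are -1, so it
  occurs once per cycle. A shift preserving the tail must move it to another such place, hence is a
  positive multiple of \<open>n\<close>.\<close>

lemma eventual_period_segment_ge:
  assumes p: "Factorial_Ring.prime p" and n: "1 \<le> n" "n \<le> int p"
    and g: "\<And>i. l \<le> i \<Longrightarrow> g i = cycle (segment p n) !! (i - l)"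
    and T: "eventual_period g T"
  shows "nat n \<le> T"
proof -
  let ?u = "segment p n"
  have len: "length ?u = nat n"
    using n rat_mod_of_int[OF p, of "n - 1"] by (simp add: segment_def del: of_int_diff)
  have u: "?u \<noteq> []" by (simp add: segment_def)
  obtain n0 where n0: "\<And>i. n0 \<le> i \<Longrightarrow> g (i + T) = g i"
    using T by (auto simp: eventual_period_def eventually_sequentially)
  \<comment> \<open>A start of a cycle lying beyond \<open>n0\<close>.\<close>
  define i where "i = l + nat n * n0"
  have "n0 \<le> nat n * n0" using n by (cases "nat n") auto
  then have "g (i + T) = g i" by (intro n0) (simp only: i_def trans_le_add2)
  moreover have "g i = ?u ! 0" using g[of i] cycle_snth[OF u] len by (simp add: i_def)
  moreover have "g (i + T) = ?u ! (T mod nat n)"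
    using g[of "i + T"] cycle_snth[OF u] len by (simp add: i_def add.assoc)
  ultimately have eq: "?u ! (T mod nat n) = ?u ! 0" by simp
  have "T mod nat n = 0"
  proof (rule ccontr)
    assume nz: "T mod nat n \<noteq> 0"
    then obtain j where j: "T mod nat n = Suc j" by (cases "T mod nat n") auto
    have "T mod nat n < length ?u" unfolding len using n by (intro mod_less_divisor) simp
    then have "?u ! (T mod nat n) = Fin (-1)" unfolding j by (simp add: segment_def)
    then have "of_int (n - 1) = (-1 :: rat)" using eq by (simp add: segment_def)
    then show False using n by simp
  qed
  then show ?thesis using T by (auto simp: eventual_period_def intro: dvd_imp_le)
qed


section \<open>The sequence of the \<kappa>'s along the orbit\<close>

lemma kappa_after_small:
  assumes p: "Factorial_Ring.prime p" and n: "kappa p r (Suc i) = Fin n" "1 \<le> n" "n \<le> int p"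
  shows "Suc i < j \<Longrightarrow> kappa p r j = \<infinity>"
proof (induction j rule: less_induct)
  case (less j)
  from less.prems obtain k where k: "j = Suc (Suc k)" "i \<le> k"
    by (metis Suc_less_eq2 less_Suc_eq_le Suc_le_D less_eq_Suc_le)
  show ?case
  \<comment> \<open>At \<open>k = i\<close> the floor of \<open>n - 1\<close> is 0, of infinite
    valuation; from then on the recursion passes infinity along.\<close>
  proof (cases "k = i")
    case True
    then show ?thesis using n k rat_floor_pred_eq_0[OF p n(2,3)] by (simp del: of_int_diff)
  next
    case False
    then have "kappa p r (Suc k) = \<infinity>" using less.IH[of "Suc k"] k by simp
    then show ?thesis using k by simp
  qed
qed

text \<open>Here \<open>q\<close> is the orbit point after the initial descent and the first
  \<open>i\<close> segments, and its valuation is the next \<kappa>. The bound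
  \<open>n + int i\<close> keeps track of the strict decrease and serves to prove
  termination.\<close>

lemma kappa_reaches:
  assumes p: "Factorial_Ring.prime p" and r: "0 \<le> nu p r" "rat_floor p r \<noteq> 0"
  shows "\<forall>j<i. \<not> kappa p r (Suc j) \<le> Fin (int p) \<Longrightarrow>
    \<exists>q n. kappa p r (Suc i) = Fin n \<and> nu p q = Fin n \<and> 1 \<le> n \<and>
      n + int i \<le> fin_part (kappa p r 1) \<and>
      reaches p r (replicate (rat_mod p r) (Fin (-1)) @
        concat (map (\<lambda>i. segment p (fin_part (kappa p r i))) [1..<Suc i])) q"
proof (induction i)
  case 0
  obtain n where n: "nu p (rat_floor p r) = Fin n" using r(2) by (rule nu_finite)
  moreover have "1 \<le> n" using nu_rat_floor_ge_1[OF p r(1)] n by (simp add: one_extended_def)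
  ultimately show ?case using reaches_rat_floor[OF p r(1)] by auto
next
  case (Suc i)
  let ?us = "\<lambda>i. replicate (rat_mod p r) (Fin (-1)) @
        concat (map (\<lambda>i. segment p (fin_part (kappa p r i))) [1..<Suc i])"
  from Suc obtain q n where q: "kappa p r (Suc i) = Fin n" "nu p q = Fin n" "1 \<le> n"
      "n + int i \<le> fin_part (kappa p r 1)" "reaches p r (?us i) q"
    by auto
  have "int p < n" using Suc.prems q(1) by (metis lessI less_eq_extended.simps(1) not_le)
  then obtain m where m: "nu p (rat_floor p (of_int (n - 1))) = Fin m" "1 \<le> m" "m < n"
    by (rule nu_rat_floor_pred[OF p])
  let ?q = "q + rat_floor p (of_int (n - 1))"
  \<comment> \<open>Since \<open>m < n\<close>, the added floor has the smaller valuation and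
    determines that of the sum.\<close>
  have "nu p ?q = Fin m"
    using nu_add_eq[OF p, of "rat_floor p (of_int (n - 1))" q] m q(2) by (simp add: add.commute)
  moreover have "kappa p r (Suc (Suc i)) = Fin m" using q(1) m(1) by (simp del: of_int_diff)
  moreover have "m + int (Suc i) \<le> fin_part (kappa p r 1)" using m q(4) by simp
  moreover have "reaches p r (?us (Suc i)) ?q"
    using reaches_append[OF q(5) reaches_segment[OF p q(2,3)]] q(1) by simp
  ultimately show ?case using m(2) by blast
qed

text \<open>If all values exceeded \<open>p\<close>, the bound of \<open>kappa_reaches\<close> at
  the index given by the first \<kappa> would leave no room for \<open>1 \<le> n\<close>. The least
  index is taken so that \<open>kappa_reaches\<close> applies there.\<close>

lemma kappa_small_exists:
  assumes p: "Factorial_Ring.prime p" and r: "0 \<le> nu p r" "rat_floor p r \<noteq> 0"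
  obtains i where "1 \<le> kappa p r (Suc i)" "kappa p r (Suc i) \<le> Fin (int p)"
    "\<forall>j<i. \<not> kappa p r (Suc j) \<le> Fin (int p)"
proof -
  have "\<exists>i. kappa p r (Suc i) \<le> Fin (int p)"
  proof (rule ccontr)
    assume "\<not> ?thesis"
    then obtain n where "1 \<le> n" "n + int (nat (fin_part (kappa p r 1))) \<le> fin_part (kappa p r 1)"
      using kappa_reaches[OF p r, of "nat (fin_part (kappa p r 1))"] by blast
    then show False by linarith
  qed
  then obtain i where i: "kappa p r (Suc i) \<le> Fin (int p)"
      "\<forall>j<i. \<not> kappa p r (Suc j) \<le> Fin (int p)"
    using exists_least_iff[of "\<lambda>i. kappa p r (Suc i) \<le> Fin (int p)"] by blast
  then have "1 \<le> kappa p r (Suc i)"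
    using kappa_reaches[OF p r i(2)] by (auto simp: one_extended_def)
  with i show ?thesis using that by blast
qed

lemma small_kappa_finite:
  assumes "0 < N" "1 \<le> kappa p r N" "kappa p r N \<le> Fin (int p)"
  obtains i n where "N = Suc i" "kappa p r (Suc i) = Fin n" "1 \<le> n" "n \<le> int p"
  using assms by (cases N; cases "kappa p r N") (auto simp: one_extended_def)

text \<open>Past one such index every value is infinite, so neither of the two can come after the
  other.\<close>

lemma kappa_small_unique:
  assumes p: "Factorial_Ring.prime p"
    and N: "0 < N" "1 \<le> kappa p r N" "kappa p r N \<le> Fin (int p)"
    and M: "0 < M" "1 \<le> kappa p r M" "kappa p r M \<le> Fin (int p)"
  shows "N = M"
proof -
  obtain i n where i: "N = Suc i" "kappa p r (Suc i) = Fin n" "1 \<le> n" "n \<le> int p"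
    using N by (rule small_kappa_finite)
  obtain j m where j: "M = Suc j" "kappa p r (Suc j) = Fin m" "1 \<le> m" "m \<le> int p"
    using M by (rule small_kappa_finite)
  show ?thesis
    using kappa_after_small[OF p i(2-4), of M] kappa_after_small[OF p j(2-4), of N] i j
    by (cases N M rule: linorder_cases) auto
qed

section \<open>From the derivative on \<open>K\<close> to the orbit of
  \<open>val_step\<close>\<close>

lemma nu_seq_eq_val_step:
  assumes p: "Factorial_Ring.prime p"
    and ext: "finite_extension_Qp p K h" and v: "discrete_valuation K v" "extends_nu_Qp p h v"
    and x: "x \<in> carrier K" "v x = Fin r"
    and fin: "\<not> eventually (\<lambda>i. nu_seq p K h v x i = \<infinity>) sequentially"
  shows "nu_seq p K h v x i = Fin ((val_step p ^^ i) r)" "(val_step p ^^ i) r \<noteq> 0"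
proof -
  let ?y = "\<lambda>i. (arith_deriv p K h v ^^ i) x"
  let ?w = "\<lambda>i. (val_step p ^^ i) r"
  \<comment> \<open>An iterate of infinite valuation is zero, so all later iterates are zero,
    against \<open>fin\<close>.\<close>
  have absorb: "v (?y i) \<noteq> \<infinity>" if "?y i \<in> carrier K" for i
  proof
    assume "v (?y i) = \<infinity>"
    then have z: "?y (Suc i) = \<zero>\<^bsub>K\<^esub>"
      using arith_deriv_infinite_valuation[OF v(1) that] by simp
    have "?y j = \<zero>\<^bsub>K\<^esub>" if "Suc i \<le> j" for j
      using that
    proof (induction rule: dec_induct)
      case (step j)
      then show ?case by (simp add: arith_deriv_def[of p K h v "\<zero>\<^bsub>K\<^esub>"])
    qed (rule z)
    then have "nu_seq p K h v x j = \<infinity>" if "Suc i \<le> j" for j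
      using that v(1) by (simp add: nu_seq_def discrete_valuation_def)
    then show False using fin eventually_sequentially by blast
  qed
  \<comment> \<open>At an orbit point 0 the next derivative would have infinite valuation, which
    \<open>absorb\<close> excludes.\<close>
  have nz: "?w i \<noteq> 0" if "?y i \<in> carrier K" "v (?y i) = Fin (?w i)" for i
    using arith_deriv_valuation[OF p ext v that] absorb[of "Suc i"] by auto
  have "?y i \<in> carrier K \<and> v (?y i) = Fin (?w i)" for i
  proof (induction i)
    case (Suc i)
    then show ?case
      using arith_deriv_valuation[OF p ext v, of "?y i" "?w i"] nz[of i] by simp
  qed (simp add: x)
  then show "nu_seq p K h v x i = Fin (?w i)" "?w i \<noteq> 0" using nz by (auto simp: nu_seq_def)
qed

section \<open>The increment sequence of \<open>x\<close> and the least periods\<close>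

theorem theorem2p8:
  fixes p :: nat
    and K :: "('k, 'm) ring_scheme"
    and h :: "(nat \<Rightarrow> rat) set \<Rightarrow> 'k"
    and v :: "'k \<Rightarrow> rat extended"
    and x :: 'k
    and b :: rat
    and k :: nat
    and \<kappa> :: "nat \<Rightarrow> int extended"
  assumes "Factorial_Ring.prime p"
    and "finite_extension_Qp p K h"
    and "discrete_valuation K v"
    and "extends_nu_Qp p h v"
    and "x \<in> carrier K" and "x \<noteq> \<zero>\<^bsub>K\<^esub>"
    and "v x = Fin (b * of_nat p ^ k)" and "nu p b = 0"
    and kappa: "\<kappa> = kappa p (fin_part (v x))"
    and "\<not> eventually (\<lambda>i. nu_seq p K h v x i = \<infinity>) sequentially"
  shows "(\<exists>!N. 0 < N \<and> 1 \<le> \<kappa> N \<and> \<kappa> N \<le> Fin (int p)) \<and>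
    (\<forall>N. 0 < N \<and> 1 \<le> \<kappa> N \<and> \<kappa> N \<le> Fin (int p) \<longrightarrow>
      (\<forall>i>N. \<kappa> i = \<infinity>) \<and>
      smap (inc_seq p K h v x) nats =
        replicate (nat (fin_part (\<kappa> 0))) (Fin (-1)) @-
        concat (map (\<lambda>i. segment p (fin_part (\<kappa> i))) [1..<Suc N]) @-
        cycle (segment p (fin_part (\<kappa> N))) \<and>
      eventually_periodic_of_period (nu_seq p K h v x) (nat (fin_part (\<kappa> N))) \<and>
      eventually_periodic_of_period (inc_seq p K h v x) (nat (fin_part (\<kappa> N))))"
proof -
  note p = assms(1)
  define r where "r = b * of_nat p ^ k"
  have vx: "v x = Fin r" and \<kappa>: "\<kappa> = kappa p r" using assms(7) kappa by (simp_all add: r_def)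
  let ?w = "\<lambda>i. (val_step p ^^ i) r"
  have w: "nu_seq p K h v x i = Fin (?w i)" "?w i \<noteq> 0" for i
    using nu_seq_eq_val_step[OF p assms(2-5) vx assms(10)] by auto
  have inc: "inc_seq p K h v x i = increments p r !! i" for i
    by (simp add: inc_seq_def w(1) increments_def)
  have r0: "0 \<le> nu p r"
    using assms(8) nu_of_int_nonneg[OF p, of "int p ^ k"] by (simp add: r_def nu_mult[OF p])
  \<comment> \<open>The floor is itself a point of the orbit, hence nonzero; this makes the first
    \<kappa> finite.\<close>
  have "?w (rat_mod p r) = rat_floor p r"
    using reaches_rat_floor[OF p r0] by (simp add: reaches_def)
  then have fl: "rat_floor p r \<noteq> 0" using w(2) by metis
  obtain l where l: "1 \<le> kappa p r (Suc l)" "kappa p r (Suc l) \<le> Fin (int p)"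
      "\<forall>j<l. \<not> kappa p r (Suc j) \<le> Fin (int p)"
    by (rule kappa_small_exists[OF p r0 fl])
  let ?small = "\<lambda>N. 0 < N \<and> 1 \<le> \<kappa> N \<and> \<kappa> N \<le> Fin (int p)"
  have "\<exists>!N. ?small N"
    unfolding \<kappa> using l(1,2) kappa_small_unique[OF p] by (intro ex_ex1I) blast+
  moreover have "(\<forall>i>N. \<kappa> i = \<infinity>) \<and>
      smap (inc_seq p K h v x) nats =
        replicate (nat (fin_part (\<kappa> 0))) (Fin (-1)) @-
        concat (map (\<lambda>i. segment p (fin_part (\<kappa> i))) [1..<Suc N]) @-
        cycle (segment p (fin_part (\<kappa> N))) \<and>
      eventually_periodic_of_period (nu_seq p K h v x) (nat (fin_part (\<kappa> N))) \<and>
      eventually_periodic_of_period (inc_seq p K h v x) (nat (fin_part (\<kappa> N)))"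
    if N: "?small N" for N
  proof -
    \<comment> \<open>By uniqueness \<open>N\<close> is the first index of small value, so
      \<open>kappa_reaches\<close> covers everything before it.\<close>
    have N_eq: "N = Suc l" using N l(1,2) kappa_small_unique[OF p] unfolding \<kappa> by blast
    then obtain n where i: "\<kappa> N = Fin n" "1 \<le> n" "n \<le> int p"
      using N small_kappa_finite unfolding \<kappa> by metis
    from kappa_reaches[OF p r0 fl l(3)] obtain q where q: "nu p q = Fin n"
      "reaches p r (replicate (rat_mod p r) (Fin (-1)) @
        concat (map (\<lambda>i. segment p (fin_part (\<kappa> i))) [1..<N])) q"
      (is "reaches p r ?us q")
      using N_eq i unfolding \<kappa> by auto
    note per = periodic_increments[OF p q(1) i(2,3)]
    have incr: "increments p r = ?us @- cycle (segment p n)"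
      using q(2) per(2) by (simp add: reaches_def)
    \<comment> \<open>The prefix \<open>?us\<close> stops before the segment of index
      \<open>N\<close>; one copy is split off the cycle to match the range
      \<open>[1..<Suc N]\<close>.\<close>
    have "cycle (segment p n) = segment p n @- cycle (segment p n)"
      by (rule cycle_decomp) (simp add: segment_def)
    moreover have "smap (inc_seq p K h v x) nats = increments p r"
      by (simp add: smap_alt inc)
    ultimately have shape: "smap (inc_seq p K h v x) nats =
        replicate (nat (fin_part (\<kappa> 0))) (Fin (-1)) @-
        concat (map (\<lambda>i. segment p (fin_part (\<kappa> i))) [1..<Suc N]) @-
        cycle (segment p (fin_part (\<kappa> N)))"
      using incr i N_eq by (simp add: \<kappa>)
    have wq: "?w (length ?us) = q" "(val_step p ^^ nat n) q = q"
      using q(2) per(1,3) by (simp_all add: reaches_def)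
    \<comment> \<open>Once the orbit is at \<open>q\<close> it returns there after \<open>n\<close>
      steps, so all later points repeat as well.\<close>
    have wper: "?w (m + nat n) = ?w m" if "length ?us \<le> m" for m
    proof -
      define d where "d = m - length ?us"
      have m: "m = d + length ?us" using that by (simp add: d_def)
      have "?w (m + nat n) = (val_step p ^^ (d + (nat n + length ?us))) r"
        by (simp only: m ac_simps)
      also have "\<dots> = (val_step p ^^ d) q"
        using wq by (simp only: funpow_add o_apply)
      also have "\<dots> = ?w m" using wq(1) by (simp only: m funpow_add o_apply)
      finally show ?thesis .
    qed
    have n0: "0 < nat n" using i by simp
    have nu_per: "eventual_period (nu_seq p K h v x) (nat n)"
      unfolding eventual_period_def eventually_sequentially w(1) using wper n0 by blast
    \<comment> \<open>Any period of the valuations is one of the increments, so a lower bound for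
      periods of the increments gives minimality for both sequences.\<close>
    have inc_of_nu: "eventual_period (inc_seq p K h v x) T"
      if T: "eventual_period (nu_seq p K h v x) T" for T
    proof -
      obtain n0 where n0: "\<And>i. n0 \<le> i \<Longrightarrow> nu_seq p K h v x (i + T) = nu_seq p K h v x i"
        using T by (auto simp: eventual_period_def eventually_sequentially)
      have "inc_seq p K h v x (i + T) = inc_seq p K h v x i" if "n0 \<le> i" for i
        using n0[of i] n0[of "Suc i"] that by (simp add: inc_seq_def)
      then show ?thesis using T by (auto simp: eventual_period_def eventually_sequentially)
    qed
    have min: "nat n \<le> T" if "eventual_period (inc_seq p K h v x) T" for T
    proof (rule eventual_period_segment_ge[OF p i(2,3) _ that])
      show "inc_seq p K h v x m = cycle (segment p n) !! (m - length ?us)" if "length ?us \<le> m" for m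
        unfolding inc incr using that by (rule shift_snth_ge)
    qed
    have "\<forall>j>N. \<kappa> j = \<infinity>"
      using kappa_after_small[OF p _ i(2,3), of r] i(1) N_eq unfolding \<kappa> by blast
    then show ?thesis
      using shape nu_per inc_of_nu min i(1) by (simp add: eventually_periodic_of_period_def)
  qed
  ultimately show ?thesis by blast
qed

end
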